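(* Let $(\Phi,\Psi,\phi,\psi)\in\mathscr{Y}\uplus\mathscr{G}$ and let $(X,\mathfrak{M},\mu)$ be a measure space endowed with a ball-basis $\mathfrak{B}$. Let $\mathfrak{A}$ be an index set and suppose that $\{T_\alpha\}_{\alpha\in\mathfrak{A}}$ is a family of $\Psi$-bounded oscillation operators on $(X,\mathfrak{M},\mu)$ satisfying $$\mathscr{C}_1^{\mathfrak{A}}:=\sup_{\alpha\in\mathfrak{A}}\mathscr{C}_1(T_\alpha)<\infty\quad\text{and}\quad\mathscr{C}_2^{\mathfrak{A}}:=\sup_{\alpha\in\mathfrak{A}}\mathscr{C}_2(T_\alpha)<\infty.$$ Let $T^{\mathfrak{A}}f(x):=\sup_{\alpha\in\mathfrak{A}}|T_\alpha f(x)|$ and let $\mathbb{B}$ be the Banach space of functions $F:\mathfrak{A}\to\mathbb{R}$ with $\|F\|_{\mathbb{B}}:=\sup_{\alpha\in\mathfrak{A}}|F(\alpha)|<\infty$. Then $T^{\mathfrak{A}}$ is a $\mathbb{B}$-valued $\Psi$-bounded oscillation operator with respect to $\mathfrak{B}$, and its constants satisfy $$\mathscr{C}_1(T^{\mathfrak{A}})\le\mathscr{C}_1^{\mathfrak{A}}\quad\text{and}\quad\mathscr{C}_2(T^{\mathfrak{A}})\le\mathscr{C}_2^{\mathfrak{A}}.$$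
   Context: **Ball-basis.** Let $(X,\mathfrak{M},\mu)$ be a measure space. A family $\mathfrak{B}\subset\mathfrak{M}$ (its members are called balls) is a ball-basis if: (B1) $0<\mu(B)<\infty$ for all $B\in\mathfrak{B}$; (B2) any two points $x,y\in X$ lie in a common $B\in\mathfrak{B}$; (B3) for every $E\in\mathfrak{M}$ and $\varepsilon>0$ there is a finite or infinite sequence $\{B_k\}\subset\mathfrak{B}$ with $\mu(E\,\Delta\,\bigcup_kB_k)<\varepsilon$; (B4) each $B\in\mathfrak{B}$ has a ball-hull $B^{\P}\in\mathfrak{B}$ containing $\bigcup\{B'\in\mathfrak{B}: B'\cap B\ne\varnothing,\ \mu(B')\le2\mu(B)\}$, such that $A\subset B\Rightarrow A^{\P}\subset B^{\P}$ and $\mu(B^{\P})\le\mathscr{C}_0\,\mu(B)$, where $\mathscr{C}_0\ge1$ is a fixed constant. **Function classes.** $\mathscr{Y}$: all Young functions $\Phi:[0,\infty]\to[0,\infty]$ (convex, left-continuous, $\lim_{t\to0^+}\Phi(t)=\Phi(0)=0$, $\lim_{t\to\infty}\Phi(t)=\Phi(\infty)=\infty$) with $0<\Phi(t)<\infty$ for $0<t<\infty$. $\mathscr{G}$: all $\varphi:(0,\infty)\to(0,\infty)$ for which there are $C_{dc},C_{ic}>0$ with $\varphi(r)\ge C_{dc}\varphi(s)$ and $r\varphi(r)\le C_{ic}\,s\varphi(s)$ whenever $r\le s$. $(\Phi,\Psi,\phi,\psi)\in\mathscr{Y}\uplus\mathscr{G}$ means: $\Phi,\Psi\in\mathscr{Y}$,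 $\phi,\psi\in\mathscr{G}$, and there are constants $C(\Phi,\Psi),C(\psi,\phi)>0$ with $\Phi(t)\le\Psi(C(\Phi,\Psi)t)$ and $\psi(t)\le C(\psi,\phi)\phi(t)$ for all $t$. **Norms and spaces.** For $B\in\mathfrak{B}$: $\|f\|_{\Phi,\phi,B}=\inf\{s>0:\frac{1}{\mu(B)\phi(\mu(B))}\int_B\Phi(|f|/s)\,d\mu\le1\}$; $\langle\|f\|\rangle_{\Phi,\phi,B}=\sup_{B'\in\mathfrak{B},\,B'\supset B}\|f\|_{\Phi,\phi,B'}$. $L^{(\Phi,\phi)}(X)$ is the set of $f\in L^1_{\rm loc}(X)$ with $\|f\|_{L^{(\Phi,\phi)}}=\sup_{B\in\mathfrak{B}}\|f\|_{\Phi,\phi,B}<\infty$. $\mathbb{I}_E$ is the indicator function of $E$. **$\Psi$-BOO.** Given $(\Phi,\Psi,\phi,\psi)\in\mathscr{Y}\uplus\mathscr{G}$ and a Banach space $\mathbb{B}$, $T$ is a $\mathbb{B}$-valued $\Psi$-bounded oscillation operator ($\Psi$-BOO) with respect to $\mathfrak{B}$ if there are constants $\mathscr{C}_1(T),\mathscr{C}_2(T)\in(0,\infty)$ and a $\mathbb{B}$-valued linear operator $\mathscr{T}$ with $Tf(x)=\|\mathscr{T}f(x)\|_{\mathbb{B}}$ for all $x\in X$ (or, if $\mathbb{B}=\mathbb{R}$, a real-valued linear or sublinear operator $\mathscr{T}=T$) such that for every $f\in L^{(\Psi,\psi)}(X)$: (I) for every $B_0\in\mathfrak{B}$ with $B_0^{\P}\subsetneq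 X$ there is $B\in\mathfrak{B}$ with $B\supsetneq B_0$ and $\sup_{x\in B_0}\|\mathscr{T}(f\mathbb{I}_{B^{\P}})(x)-\mathscr{T}(f\mathbb{I}_{B_0^{\P}})(x)\|_{\mathbb{B}}\le\mathscr{C}_1(T)\|f\|_{\Phi,\phi,B^{\P}}$; (II) for every $B\in\mathfrak{B}$, $\sup_{x,x'\in B}\|(\mathscr{T}f-\mathscr{T}(f\mathbb{I}_{B^{\P}}))(x)-(\mathscr{T}f-\mathscr{T}(f\mathbb{I}_{B^{\P}}))(x')\|_{\mathbb{B}}\le\mathscr{C}_2(T)\langle\|f\|\rangle_{\Phi,\phi,B}$. When the space $\mathbb{B}$ is not mentioned (as for the $T_\alpha$), $\mathbb{B}=\mathbb{R}$.
   Formalization: Added assumptions: for each f and B_0 the ball B in (I) can be chosen the same for all α, and sup_α|T_α f(x)| is finite for all f in L^(Ψ,ψ) and x. If some T_α are only sublinear, the 𝔹-valued operator representing T^𝔄 is sublinear in norm rather than linear. *)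

theory Defs
  imports "HOL-Analysis.Analysis" "HOL-Probability.Discrete_Topology"
begin

section \<open>Ball-bases\<close>

text \<open>
  The underlying set is \<^term>\<open>space M\<close>. The ball-hull map \<^term>\<open>bhull\<close> and the constant
  \<^term>\<open>C0\<close> are part of the data. The finite or infinite sequences of the approximation axiom are
  rendered as countable, possibly empty, subfamilies.
\<close>

definition ball_basis ::
  "'a measure \<Rightarrow> 'a set set \<Rightarrow> ('a set \<Rightarrow> 'a set) \<Rightarrow> real \<Rightarrow> bool" where
  "ball_basis M BB bhull C0 \<longleftrightarrow>
     BB \<subseteq> sets M \<and>
     (\<forall>B\<in>BB. 0 < emeasure M B \<and> emeasure M B < \<infinity>) \<and>
     (\<forall>x\<in>space M. \<forall>y\<in>space M. \<exists>B\<in>BB. x \<in> B \<and> y \<in> B) \<and>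
     (\<forall>E\<in>sets M. \<forall>\<epsilon>>0. \<exists>\<C>. \<C> \<subseteq> BB \<and> countable \<C> \<and>
        emeasure M ((E - \<Union>\<C>) \<union> (\<Union>\<C> - E)) < ennreal \<epsilon>) \<and>
     C0 \<ge> 1 \<and>
     (\<forall>B\<in>BB. bhull B \<in> BB \<and>
        \<Union>{B'\<in>BB. B' \<inter> B \<noteq> {} \<and> emeasure M B' \<le> 2 * emeasure M B} \<subseteq> bhull B \<and>
        emeasure M (bhull B) \<le> ennreal C0 * emeasure M B) \<and>
     (\<forall>A\<in>BB. \<forall>B\<in>BB. A \<subseteq> B \<longrightarrow> bhull A \<subseteq> bhull B)"

section \<open>Young functions and growth functions\<close>

definition young_class :: "(ennreal \<Rightarrow> ennreal) set" where
  "young_class = {\<Phi>.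
     (\<forall>x y u v. u + v = 1 \<longrightarrow> \<Phi> (u * x + v * y) \<le> u * \<Phi> x + v * \<Phi> y) \<and>
     (\<forall>t. (\<Phi> \<longlongrightarrow> \<Phi> t) (at_left t)) \<and>
     (\<Phi> \<longlongrightarrow> 0) (at_right 0) \<and> \<Phi> 0 = 0 \<and>
     (\<Phi> \<longlongrightarrow> \<infinity>) (at_left \<infinity>) \<and> \<Phi> \<infinity> = \<infinity> \<and>
     (\<forall>t. 0 < t \<and> t < \<infinity> \<longrightarrow> 0 < \<Phi> t \<and> \<Phi> t < \<infinity>)}"

text \<open>Only the values of \<^term>\<open>\<phi>\<close> on \<open>(0,\<infinity>)\<close> matter here and below.\<close>

definition growth_class :: "(real \<Rightarrow> real) set" where
  "growth_class = {\<phi>.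
     (\<forall>r>0. \<phi> r > 0) \<and>
     (\<exists>Cdc>0. \<exists>Cic>0. \<forall>r s. 0 < r \<and> r \<le> s \<longrightarrow>
        \<phi> r \<ge> Cdc * \<phi> s \<and> r * \<phi> r \<le> Cic * (s * \<phi> s))}"

definition young_growth ::
  "(ennreal \<Rightarrow> ennreal) \<Rightarrow> (ennreal \<Rightarrow> ennreal) \<Rightarrow> (real \<Rightarrow> real) \<Rightarrow> (real \<Rightarrow> real) \<Rightarrow> bool" where
  "young_growth \<Phi> \<Psi> \<phi> \<psi> \<longleftrightarrow>
     \<Phi> \<in> young_class \<and> \<Psi> \<in> young_class \<and> \<phi> \<in> growth_class \<and> \<psi> \<in> growth_class \<and>
     (\<exists>C>0. \<forall>t. \<Phi> t \<le> \<Psi> (ennreal C * t)) \<and>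
     (\<exists>C>0. \<forall>t>0. \<psi> t \<le> C * \<phi> t)"

section \<open>Norms and spaces\<close>

text \<open>
  The norms take values in \<open>[0,\<infinity>]\<close>, the infimum of the empty set being \<open>\<infinity>\<close>.
\<close>

definition ball_norm ::
  "'a measure \<Rightarrow> (ennreal \<Rightarrow> ennreal) \<Rightarrow> (real \<Rightarrow> real) \<Rightarrow> 'a set \<Rightarrow> ('a \<Rightarrow> real) \<Rightarrow> ennreal" where
  "ball_norm M \<Phi> \<phi> B f =
     (INF s\<in>{s::real. s > 0 \<and>
        ennreal (1 / (measure M B * \<phi> (measure M B))) *
          (\<integral>\<^sup>+x\<in>B. \<Phi> (ennreal (\<bar>f x\<bar> / s)) \<partial>M) \<le> 1}. ennreal s)"

definition sup_ball_norm ::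
  "'a measure \<Rightarrow> 'a set set \<Rightarrow> (ennreal \<Rightarrow> ennreal) \<Rightarrow> (real \<Rightarrow> real) \<Rightarrow> 'a set \<Rightarrow> ('a \<Rightarrow> real) \<Rightarrow> ennreal"
where
  "sup_ball_norm M BB \<Phi> \<phi> B f = (SUP B'\<in>{B'\<in>BB. B \<subseteq> B'}. ball_norm M \<Phi> \<phi> B' f)"

definition L1_loc :: "'a measure \<Rightarrow> 'a set set \<Rightarrow> ('a \<Rightarrow> real) set" where
  "L1_loc M BB = {f \<in> borel_measurable M. \<forall>B\<in>BB. set_integrable M B f}"

definition orlicz_morrey ::
  "'a measure \<Rightarrow> 'a set set \<Rightarrow> (ennreal \<Rightarrow> ennreal) \<Rightarrow> (real \<Rightarrow> real) \<Rightarrow> ('a \<Rightarrow> real) set" where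
  "orlicz_morrey M BB \<Phi> \<phi> = {f \<in> L1_loc M BB. (SUP B\<in>BB. ball_norm M \<Phi> \<phi> B f) < \<infinity>}"

abbreviation cut_to :: "('a \<Rightarrow> real) \<Rightarrow> 'a set \<Rightarrow> 'a \<Rightarrow> real" where
  "cut_to f E \<equiv> (\<lambda>x. f x * indicator E x)"

section \<open>Bounded oscillation operators\<close>

text \<open>
  Operators act on the function space \<open>L\<close> (below, \<^term>\<open>orlicz_morrey M BB \<Psi> \<psi>\<close>) and produce
  functions that are defined at every point of \<open>X\<close>. Sublinearity is that of harmonic analysis,
  \<open>|T(f + g)| \<le> |Tf| + |Tg|\<close> and \<open>|T(cf)| = |c| |Tf|\<close>, with the norm in place of the absolute value
  for operators with values in a Banach space.
\<close>

definition linear_operator ::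
  "'a set \<Rightarrow> ('a \<Rightarrow> real) set \<Rightarrow> (('a \<Rightarrow> real) \<Rightarrow> 'a \<Rightarrow> 'b::real_normed_vector) \<Rightarrow> bool" where
  "linear_operator X L \<T> \<longleftrightarrow>
     (\<forall>f\<in>L. \<forall>g\<in>L. \<forall>x\<in>X. \<T> (\<lambda>y. f y + g y) x = \<T> f x + \<T> g x) \<and>
     (\<forall>f\<in>L. \<forall>c. \<forall>x\<in>X. \<T> (\<lambda>y. c * f y) x = c *\<^sub>R \<T> f x)"

definition sublinear_operator ::
  "'a set \<Rightarrow> ('a \<Rightarrow> real) set \<Rightarrow> (('a \<Rightarrow> real) \<Rightarrow> 'a \<Rightarrow> 'b::real_normed_vector) \<Rightarrow> bool" where
  "sublinear_operator X L \<T> \<longleftrightarrow>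
     (\<forall>f\<in>L. \<forall>g\<in>L. \<forall>x\<in>X. norm (\<T> (\<lambda>y. f y + g y) x) \<le> norm (\<T> f x) + norm (\<T> g x)) \<and>
     (\<forall>f\<in>L. \<forall>c. \<forall>x\<in>X. norm (\<T> (\<lambda>y. c * f y) x) = \<bar>c\<bar> * norm (\<T> f x))"

text \<open>The inequality of condition (I), for a ball \<open>B\<^sub>0\<close> and a larger ball \<open>B\<close>.\<close>

definition boo_ineq_I ::
  "'a measure \<Rightarrow> ('a set \<Rightarrow> 'a set) \<Rightarrow> (ennreal \<Rightarrow> ennreal) \<Rightarrow> (real \<Rightarrow> real) \<Rightarrow>
   (('a \<Rightarrow> real) \<Rightarrow> 'a \<Rightarrow> 'b::real_normed_vector) \<Rightarrow> real \<Rightarrow> ('a \<Rightarrow> real) \<Rightarrow> 'a set \<Rightarrow> 'a set \<Rightarrow> bool"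
where
  "boo_ineq_I M bhull \<Phi> \<phi> \<T> C1 f B\<^sub>0 B \<longleftrightarrow>
     (SUP x\<in>B\<^sub>0. ennreal (norm (\<T> (cut_to f (bhull B)) x - \<T> (cut_to f (bhull B\<^sub>0)) x)))
       \<le> ennreal C1 * ball_norm M \<Phi> \<phi> (bhull B) f"

definition boo_ineq_II ::
  "'a measure \<Rightarrow> 'a set set \<Rightarrow> ('a set \<Rightarrow> 'a set) \<Rightarrow> (ennreal \<Rightarrow> ennreal) \<Rightarrow> (real \<Rightarrow> real) \<Rightarrow>
   (('a \<Rightarrow> real) \<Rightarrow> 'a \<Rightarrow> 'b::real_normed_vector) \<Rightarrow> real \<Rightarrow> ('a \<Rightarrow> real) \<Rightarrow> 'a set \<Rightarrow> bool" where
  "boo_ineq_II M BB bhull \<Phi> \<phi> \<T> C2 f B \<longleftrightarrow>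
     (SUP x\<in>B. SUP x'\<in>B. ennreal (norm
         ((\<T> f x - \<T> (cut_to f (bhull B)) x) - (\<T> f x' - \<T> (cut_to f (bhull B)) x'))))
       \<le> ennreal C2 * sup_ball_norm M BB \<Phi> \<phi> B f"

definition boo_bounds ::
  "'a measure \<Rightarrow> 'a set set \<Rightarrow> ('a set \<Rightarrow> 'a set) \<Rightarrow>
   (ennreal \<Rightarrow> ennreal) \<Rightarrow> (ennreal \<Rightarrow> ennreal) \<Rightarrow> (real \<Rightarrow> real) \<Rightarrow> (real \<Rightarrow> real) \<Rightarrow>
   (('a \<Rightarrow> real) \<Rightarrow> 'a \<Rightarrow> 'b::real_normed_vector) \<Rightarrow> real \<Rightarrow> real \<Rightarrow> bool" where
  "boo_bounds M BB bhull \<Phi> \<Psi> \<phi> \<psi> \<T> C1 C2 \<longleftrightarrow>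
     0 < C1 \<and> 0 < C2 \<and>
     (\<forall>f\<in>orlicz_morrey M BB \<Psi> \<psi>.
        (\<forall>B\<^sub>0\<in>BB. bhull B\<^sub>0 \<subset> space M \<longrightarrow>
           (\<exists>B\<in>BB. B\<^sub>0 \<subset> B \<and> boo_ineq_I M bhull \<Phi> \<phi> \<T> C1 f B\<^sub>0 B)) \<and>
        (\<forall>B\<in>BB. boo_ineq_II M BB bhull \<Phi> \<phi> \<T> C2 f B))"

text \<open>
  \<open>T\<close> is a \<open>\<Psi>\<close>-bounded oscillation operator with values in the Banach space \<^typ>\<open>'b\<close>, represented by
  the linear operator \<open>\<T>\<close>, and \<open>C1\<close>, \<open>C2\<close> are admissible constants.
\<close>

definition psi_boo ::
  "'a measure \<Rightarrow> 'a set set \<Rightarrow> ('a set \<Rightarrow> 'a set) \<Rightarrow>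
   (ennreal \<Rightarrow> ennreal) \<Rightarrow> (ennreal \<Rightarrow> ennreal) \<Rightarrow> (real \<Rightarrow> real) \<Rightarrow> (real \<Rightarrow> real) \<Rightarrow>
   (('a \<Rightarrow> real) \<Rightarrow> 'a \<Rightarrow> real) \<Rightarrow> (('a \<Rightarrow> real) \<Rightarrow> 'a \<Rightarrow> 'b::banach) \<Rightarrow> real \<Rightarrow> real \<Rightarrow> bool" where
  "psi_boo M BB bhull \<Phi> \<Psi> \<phi> \<psi> T \<T> C1 C2 \<longleftrightarrow>
     linear_operator (space M) (orlicz_morrey M BB \<Psi> \<psi>) \<T> \<and>
     (\<forall>f\<in>orlicz_morrey M BB \<Psi> \<psi>. \<forall>x\<in>space M. T f x = norm (\<T> f x)) \<and>
     boo_bounds M BB bhull \<Phi> \<Psi> \<phi> \<psi> \<T> C1 C2"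

text \<open>
  The same with a representing operator that is only sublinear; this is what a supremum of
  sublinear operators can satisfy, since it is in general not the norm of a linear operator.
\<close>

definition psi_boo_sublinear ::
  "'a measure \<Rightarrow> 'a set set \<Rightarrow> ('a set \<Rightarrow> 'a set) \<Rightarrow>
   (ennreal \<Rightarrow> ennreal) \<Rightarrow> (ennreal \<Rightarrow> ennreal) \<Rightarrow> (real \<Rightarrow> real) \<Rightarrow> (real \<Rightarrow> real) \<Rightarrow>
   (('a \<Rightarrow> real) \<Rightarrow> 'a \<Rightarrow> real) \<Rightarrow> (('a \<Rightarrow> real) \<Rightarrow> 'a \<Rightarrow> 'b::banach) \<Rightarrow> real \<Rightarrow> real \<Rightarrow> bool" where
  "psi_boo_sublinear M BB bhull \<Phi> \<Psi> \<phi> \<psi> T \<T> C1 C2 \<longleftrightarrow>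
     sublinear_operator (space M) (orlicz_morrey M BB \<Psi> \<psi>) \<T> \<and>
     (\<forall>f\<in>orlicz_morrey M BB \<Psi> \<psi>. \<forall>x\<in>space M. T f x = norm (\<T> f x)) \<and>
     boo_bounds M BB bhull \<Phi> \<Psi> \<phi> \<psi> \<T> C1 C2"

text \<open>
  The real-valued case: besides \<open>T = |\<T>|\<close> with \<open>\<T>\<close> linear, also \<open>\<T> = T\<close> itself with \<open>T\<close> linear or
  sublinear is admitted.
\<close>

definition real_psi_boo ::
  "'a measure \<Rightarrow> 'a set set \<Rightarrow> ('a set \<Rightarrow> 'a set) \<Rightarrow>
   (ennreal \<Rightarrow> ennreal) \<Rightarrow> (ennreal \<Rightarrow> ennreal) \<Rightarrow> (real \<Rightarrow> real) \<Rightarrow> (real \<Rightarrow> real) \<Rightarrow>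
   (('a \<Rightarrow> real) \<Rightarrow> 'a \<Rightarrow> real) \<Rightarrow> (('a \<Rightarrow> real) \<Rightarrow> 'a \<Rightarrow> real) \<Rightarrow> real \<Rightarrow> real \<Rightarrow> bool" where
  "real_psi_boo M BB bhull \<Phi> \<Psi> \<phi> \<psi> T \<T> C1 C2 \<longleftrightarrow>
     psi_boo M BB bhull \<Phi> \<Psi> \<phi> \<psi> T \<T> C1 C2 \<or>
     (\<T> = T \<and>
      (linear_operator (space M) (orlicz_morrey M BB \<Psi> \<psi>) T \<or>
       sublinear_operator (space M) (orlicz_morrey M BB \<Psi> \<psi>) T) \<and>
      boo_bounds M BB bhull \<Phi> \<Psi> \<phi> \<psi> T C1 C2)"

section \<open>Maximal operator\<close>

text \<open>A real supremum, hence meaningful only where the family is bounded in \<open>\<alpha>\<close>.\<close>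

definition sup_operator ::
  "('i \<Rightarrow> ('a \<Rightarrow> real) \<Rightarrow> 'a \<Rightarrow> real) \<Rightarrow> ('a \<Rightarrow> real) \<Rightarrow> 'a \<Rightarrow> real" where
  "sup_operator T f x = (SUP \<alpha>. \<bar>T \<alpha> f x\<bar>)"

section \<open>The Banach space of bounded functions on the index set\<close>

text \<open>
  The index set is a type \<^typ>\<open>'i\<close>. On the discrete space over \<^typ>\<open>'i\<close> every function is
  continuous, so the bounded continuous functions are all bounded functions, with the supremum norm.
\<close>

instance bcontfun :: (metric_space, banach) banach ..

type_synonym 'i bfun = "'i discrete \<Rightarrow>\<^sub>C real"

lemma norm_bfun: "norm (F :: 'i bfun) = (SUP \<alpha>. \<bar>apply_bcontfun F (discrete \<alpha>)\<bar>)"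
proof -
  have "range (\<lambda>\<alpha>. \<bar>apply_bcontfun F (discrete \<alpha>)\<bar>) = range (\<lambda>d. \<bar>apply_bcontfun F d\<bar>)"
    by (metis (no_types) UNIV_I image_image of_discrete_inverse surjI)
  then show ?thesis
    by (simp add: norm_bcontfun_def dist_bcontfun.rep_eq)
qed

lemma bfun_ex:
  fixes F :: "'i \<Rightarrow> real"
  assumes "bdd_above (range (\<lambda>\<alpha>. \<bar>F \<alpha>\<bar>))"
  shows "\<exists>!G :: 'i bfun. \<forall>\<alpha>. apply_bcontfun G (discrete \<alpha>) = F \<alpha>"
proof
  define h where "h = (\<lambda>d. F (of_discrete d))"
  have "continuous_on UNIV h"
    by (simp add: continuous_on_open_vimage open_discrete)
  moreover have "bounded (range h)"
    using assms unfolding bdd_above_def bounded_iff h_def by auto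
  ultimately have "h \<in> bcontfun" by (simp add: bcontfun_def)
  then show "\<forall>\<alpha>. apply_bcontfun (Bcontfun h) (discrete \<alpha>) = F \<alpha>"
    by (simp add: Bcontfun_inverse h_def discrete_inverse)
next
  fix G :: "'i bfun" assume G: "\<forall>\<alpha>. apply_bcontfun G (discrete \<alpha>) = F \<alpha>"
  show "G = Bcontfun (\<lambda>d. F (of_discrete d))"
  proof -
    have "apply_bcontfun G = (\<lambda>d. F (of_discrete d))"
      using G by (metis of_discrete_inverse)
    then show ?thesis by (metis apply_bcontfun_inverse)
  qed
qed

end

theory Submission
  imports Defs
begin

text \<open>
  A bounded function on the index set is controlled in the supremum norm by its coordinates, so the
  vector \<open>(\<T>\<^sub>\<alpha> f(x))\<^sub>\<alpha>\<close> inherits both oscillation inequalities, with the suprema of the constants,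
  once it is known to be bounded for each of the functions involved. For \<open>f\<close> and its truncations this is
  the finiteness of the supremum, since truncating a function stays in the Orlicz-Morrey space by
  monotonicity of Young functions; for sums and multiples it follows from (sub)linearity.
\<close>

section \<open>Truncation inside Orlicz-Morrey spaces\<close>

lemma young_class_mono:
  assumes "\<Phi> \<in> young_class" "s \<le> t"
  shows "\<Phi> s \<le> \<Phi> t"
proof (cases "t = \<infinity> \<or> s = t")
  case True
  then show ?thesis using assms by (auto simp: young_class_def)
next
  case False
  \<comment> \<open>Convexity along the segment from \<open>0\<close> to \<open>t\<close>, where
    \<open>\<Phi> 0 = 0\<close>, gives monotonicity: \<open>s\<close> is the point with weight
    \<open>u \<le> 1\<close> at \<open>t\<close>. The quotient recovers \<open>s\<close> only for
    \<open>t\<close> finite and nonzero; \<open>t = 0\<close> is ruled out because it would force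
    \<open>s = t\<close>.\<close>
  define u where "u = s / t"
  have t: "t \<noteq> 0" "t \<noteq> top" using False assms(2) by auto
  have "u \<le> 1"
    using assms(2) t unfolding u_def by (simp add: divide_le_posI_ennreal zero_less_iff_neq_zero)
  then have uv: "u + (1 - u) = 1"
    by (metis add_diff_inverse_ennreal)
  have "u * t = s"
    using t unfolding u_def
    by (simp add: ennreal_divide_times less_top)
  then have "\<Phi> s = \<Phi> (u * t + (1 - u) * 0)" by simp
  also have "\<dots> \<le> u * \<Phi> t + (1 - u) * \<Phi> 0"
    using assms(1) uv unfolding young_class_def by blast
  also have "\<dots> = u * \<Phi> t"
    using assms(1) by (simp add: young_class_def)
  also have "\<dots> \<le> 1 * \<Phi> t"
    using \<open>u \<le> 1\<close> by (rule mult_right_mono) simp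
  finally show ?thesis by simp
qed

text \<open>Every scale \<open>s\<close> admissible for \<open>g\<close> is admissible for
  \<open>f\<close>, since \<open>\<Phi>\<close> is monotone; so the infimum for \<open>f\<close>
  runs over a larger set.\<close>

lemma ball_norm_mono:
  assumes "\<Phi> \<in> young_class" "\<And>x. \<bar>f x\<bar> \<le> \<bar>g x\<bar>"
  shows "ball_norm M \<Phi> \<phi> B f \<le> ball_norm M \<Phi> \<phi> B g"
proof -
  have "(\<integral>\<^sup>+x\<in>B. \<Phi> (ennreal (\<bar>f x\<bar> / s)) \<partial>M) \<le> (\<integral>\<^sup>+x\<in>B. \<Phi> (ennreal (\<bar>g x\<bar> / s)) \<partial>M)"
    if "s > 0" for s :: real
    using that assms
    by (intro nn_integral_mono mult_right_mono young_class_mono[OF assms(1)] ennreal_leI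
        divide_right_mono) auto
  then show ?thesis
    unfolding ball_norm_def
    by (intro INF_superset_mono subsetI CollectI conjI)
      (auto elim!: order_trans[rotated] intro!: mult_left_mono)
qed

lemma ball_basisD:
  assumes "ball_basis M BB bhull C0"
  shows "BB \<subseteq> sets M" and "\<And>B. B \<in> BB \<Longrightarrow> bhull B \<in> BB"
  using assms unfolding ball_basis_def by (elim conjE, blast)+

text \<open>Both oscillation inequalities evaluate the operators at truncations, whereas finiteness
  of the supremum over the indices is assumed only on the space. This closure property bridges the
  two.\<close>

lemma cut_to_orlicz_morrey:
  assumes "\<Psi> \<in> young_class" "f \<in> orlicz_morrey M BB \<Psi> \<psi>" "E \<in> sets M"
  shows "cut_to f E \<in> orlicz_morrey M BB \<Psi> \<psi>"
proof -
  have f: "f \<in> borel_measurable M" "\<And>B. B \<in> BB \<Longrightarrow> set_integrable M B f"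
    "(SUP B\<in>BB. ball_norm M \<Psi> \<psi> B f) < \<infinity>"
    using assms(2) by (auto simp: orlicz_morrey_def L1_loc_def)
  have "set_integrable M B (cut_to f E)" if "B \<in> BB" for B
    using integrable_real_mult_indicator[OF assms(3) f(2)[OF that, unfolded set_integrable_def]]
    by (simp add: set_integrable_def mult.assoc)
  moreover have "(SUP B\<in>BB. ball_norm M \<Psi> \<psi> B (cut_to f E)) \<le> (SUP B\<in>BB. ball_norm M \<Psi> \<psi> B f)"
    by (intro SUP_mono' ball_norm_mono assms) (simp split: split_indicator)
  moreover have "cut_to f E \<in> borel_measurable M"
    using f(1) assms(3) by measurable
  ultimately show ?thesis
    using f(3) by (auto simp: orlicz_morrey_def L1_loc_def)
qed

section \<open>Coordinates and norms of bounded functions\<close>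

text \<open>Unspecified unless \<open>F\<close> is bounded.\<close>

definition bfun_of :: "('i \<Rightarrow> real) \<Rightarrow> 'i bfun" where
  "bfun_of F = (THE G. \<forall>\<alpha>. apply_bcontfun G (discrete \<alpha>) = F \<alpha>)"

lemma apply_bfun_of:
  assumes "bdd_above (range (\<lambda>\<alpha>. \<bar>F \<alpha>\<bar>))"
  shows "apply_bcontfun (bfun_of F) (discrete \<alpha>) = F \<alpha>"
  using theI'[OF bfun_ex[OF assms]] unfolding bfun_of_def by blast

lemma bfun_eqI:
  fixes F G :: "'i bfun"
  assumes "\<And>\<alpha>. apply_bcontfun F (discrete \<alpha>) = apply_bcontfun G (discrete \<alpha>)"
  shows "F = G"
  using assms by (metis bcontfun_eqI of_discrete_inverse)

lemma abs_le_norm_bfun: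
  fixes F :: "'i bfun"
  shows "\<bar>apply_bcontfun F d\<bar> \<le> norm F"
  using norm_bounded[of F d] by simp

lemma norm_bfun_le:
  fixes F :: "'i bfun"
  assumes "\<And>\<alpha>. \<bar>apply_bcontfun F (discrete \<alpha>)\<bar> \<le> c"
  shows "norm F \<le> c"
  \<comment> \<open>The index set is a type, hence nonempty, so \<open>c \<ge> 0\<close> need not be
    assumed.\<close>
  unfolding norm_bfun by (rule cSUP_least) (use assms in auto)

text \<open>The right-hand sides of (I) and (II) may be infinite. That case is trivial, and a finite
  bound reduces to the real one.\<close>

lemma ennreal_norm_bfun_le:
  fixes F :: "'i bfun"
  assumes "\<And>\<alpha>. ennreal \<bar>apply_bcontfun F (discrete \<alpha>)\<bar> \<le> c"
  shows "ennreal (norm F) \<le> c"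
proof (cases c)
  case (real r)
  then show ?thesis
    using assms by (auto intro!: ennreal_leI norm_bfun_le)
qed simp

lemma norm_bfun_of:
  assumes "bdd_above (range (\<lambda>\<alpha>. \<bar>F \<alpha>\<bar>))"
  shows "norm (bfun_of F) = (SUP \<alpha>. \<bar>F \<alpha>\<bar>)"
  by (simp add: norm_bfun apply_bfun_of[OF assms])

section \<open>Linearity and sublinearity of the vector of operators\<close>

lemma linear_imp_sublinear_operator:
  "linear_operator X L \<T> \<Longrightarrow> sublinear_operator X L \<T>"
  by (simp add: linear_operator_def sublinear_operator_def norm_triangle_ineq)

text \<open>Supplies boundedness of the coordinates at \<open>f + g\<close>, which need not lie in
  the domain \<open>L\<close> even if \<open>f\<close> and \<open>g\<close> do.\<close>

lemma bdd_above_abs_add: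
  fixes F G :: "'i \<Rightarrow> real"
  assumes "bdd_above (range (\<lambda>\<alpha>. \<bar>F \<alpha>\<bar>))" "bdd_above (range (\<lambda>\<alpha>. \<bar>G \<alpha>\<bar>))"
    and "\<And>\<alpha>. \<bar>H \<alpha>\<bar> \<le> \<bar>F \<alpha>\<bar> + \<bar>G \<alpha>\<bar>"
  shows "bdd_above (range (\<lambda>\<alpha>. \<bar>H \<alpha>\<bar>))"
proof -
  obtain a b where "\<And>\<alpha>. \<bar>F \<alpha>\<bar> \<le> a" "\<And>\<alpha>. \<bar>G \<alpha>\<bar> \<le> b"
    using assms(1,2) unfolding bdd_above_def by auto
  then have "\<bar>H \<alpha>\<bar> \<le> a + b" for \<alpha>
    using assms(3) by (meson add_mono order_trans)
  then show ?thesis by (intro bdd_aboveI2)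
qed

lemma bdd_above_abs_mult:
  fixes F :: "'i \<Rightarrow> real"
  assumes "bdd_above (range (\<lambda>\<alpha>. \<bar>F \<alpha>\<bar>))" "\<And>\<alpha>. \<bar>H \<alpha>\<bar> = \<bar>c\<bar> * \<bar>F \<alpha>\<bar>"
  shows "bdd_above (range (\<lambda>\<alpha>. \<bar>H \<alpha>\<bar>))"
proof -
  obtain a where "\<And>\<alpha>. \<bar>F \<alpha>\<bar> \<le> a"
    using assms(1) unfolding bdd_above_def by auto
  then have "\<bar>H \<alpha>\<bar> \<le> \<bar>c\<bar> * a" for \<alpha>
    by (simp add: assms(2) mult_left_mono)
  then show ?thesis by (intro bdd_aboveI2)
qed

text \<open>Vectors with equal coordinates are equal, so linearity is inherited coordinate by
  coordinate once each vector involved is known to be bounded.\<close>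

lemma linear_operator_bfun_of:
  assumes lin: "\<And>\<alpha>. linear_operator X L (\<T> \<alpha>)"
    and bdd: "\<And>f x. f \<in> L \<Longrightarrow> x \<in> X \<Longrightarrow> bdd_above (range (\<lambda>\<alpha>. \<bar>\<T> \<alpha> f x\<bar>))"
  shows "linear_operator X L (\<lambda>f x. bfun_of (\<lambda>\<alpha>. \<T> \<alpha> f x))"
proof -
  have "bfun_of (\<lambda>\<alpha>. \<T> \<alpha> (\<lambda>y. f y + g y) x) = bfun_of (\<lambda>\<alpha>. \<T> \<alpha> f x) + bfun_of (\<lambda>\<alpha>. \<T> \<alpha> g x)"
    if "f \<in> L" "g \<in> L" "x \<in> X" for f g x
  proof -
    have eq: "\<T> \<alpha> (\<lambda>y. f y + g y) x = \<T> \<alpha> f x + \<T> \<alpha> g x" for \<alpha>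
      using lin that by (simp add: linear_operator_def)
    have "bdd_above (range (\<lambda>\<alpha>. \<bar>\<T> \<alpha> (\<lambda>y. f y + g y) x\<bar>))"
      by (rule bdd_above_abs_add[OF bdd[of f x] bdd[of g x]]) (use that eq in auto)
    then show ?thesis
      using that by (intro bfun_eqI) (simp add: apply_bfun_of bdd plus_bcontfun.rep_eq eq)
  qed
  moreover have "bfun_of (\<lambda>\<alpha>. \<T> \<alpha> (\<lambda>y. c * f y) x) = c *\<^sub>R bfun_of (\<lambda>\<alpha>. \<T> \<alpha> f x)"
    if "f \<in> L" "x \<in> X" for f c x
  proof -
    have eq: "\<T> \<alpha> (\<lambda>y. c * f y) x = c * \<T> \<alpha> f x" for \<alpha>
      using lin that by (simp add: linear_operator_def)
    have "bdd_above (range (\<lambda>\<alpha>. \<bar>\<T> \<alpha> (\<lambda>y. c * f y) x\<bar>))"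
      by (rule bdd_above_abs_mult[OF bdd[OF that], of _ c]) (simp add: eq abs_mult)
    then show ?thesis
      using that by (intro bfun_eqI) (simp add: apply_bfun_of bdd scaleR_bcontfun.rep_eq eq)
  qed
  ultimately show ?thesis by (simp add: linear_operator_def)
qed

lemma sublinear_operator_bfun_of:
  assumes sub: "\<And>\<alpha>. sublinear_operator X L (\<T> \<alpha>)"
    and bdd: "\<And>f x. f \<in> L \<Longrightarrow> x \<in> X \<Longrightarrow> bdd_above (range (\<lambda>\<alpha>. \<bar>\<T> \<alpha> f x\<bar>))"
  shows "sublinear_operator X L (\<lambda>f x. bfun_of (\<lambda>\<alpha>. \<T> \<alpha> f x))"
proof -
  have "norm (bfun_of (\<lambda>\<alpha>. \<T> \<alpha> (\<lambda>y. f y + g y) x))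
      \<le> norm (bfun_of (\<lambda>\<alpha>. \<T> \<alpha> f x)) + norm (bfun_of (\<lambda>\<alpha>. \<T> \<alpha> g x))"
    if "f \<in> L" "g \<in> L" "x \<in> X" for f g x
  proof (rule norm_bfun_le)
    fix \<alpha>
    have le: "\<bar>\<T> \<alpha> (\<lambda>y. f y + g y) x\<bar> \<le> \<bar>\<T> \<alpha> f x\<bar> + \<bar>\<T> \<alpha> g x\<bar>" for \<alpha>
      using sub that by (simp add: sublinear_operator_def)
    have "bdd_above (range (\<lambda>\<alpha>. \<bar>\<T> \<alpha> (\<lambda>y. f y + g y) x\<bar>))"
      by (rule bdd_above_abs_add[OF bdd[of f x] bdd[of g x]]) (use that le in auto)
    then show "\<bar>apply_bcontfun (bfun_of (\<lambda>\<alpha>. \<T> \<alpha> (\<lambda>y. f y + g y) x)) (discrete \<alpha>)\<bar>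
        \<le> norm (bfun_of (\<lambda>\<alpha>. \<T> \<alpha> f x)) + norm (bfun_of (\<lambda>\<alpha>. \<T> \<alpha> g x))"
      using le[of \<alpha>] abs_le_norm_bfun[of "bfun_of (\<lambda>\<alpha>. \<T> \<alpha> f x)" "discrete \<alpha>"]
        abs_le_norm_bfun[of "bfun_of (\<lambda>\<alpha>. \<T> \<alpha> g x)" "discrete \<alpha>"] that
      by (simp add: apply_bfun_of bdd)
  qed
  moreover have "norm (bfun_of (\<lambda>\<alpha>. \<T> \<alpha> (\<lambda>y. c * f y) x)) = \<bar>c\<bar> * norm (bfun_of (\<lambda>\<alpha>. \<T> \<alpha> f x))"
    if "f \<in> L" "x \<in> X" for f c x
  proof -
    have eq: "\<bar>\<T> \<alpha> (\<lambda>y. c * f y) x\<bar> = \<bar>c\<bar> * \<bar>\<T> \<alpha> f x\<bar>" for \<alpha>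
      using sub that by (simp add: sublinear_operator_def)
    have "bdd_above (range (\<lambda>\<alpha>. \<bar>\<T> \<alpha> (\<lambda>y. c * f y) x\<bar>))"
      by (rule bdd_above_abs_mult[OF bdd[OF that], of _ c]) (rule eq)
    then have "norm (bfun_of (\<lambda>\<alpha>. \<T> \<alpha> (\<lambda>y. c * f y) x)) = (SUP \<alpha>. \<bar>c * \<T> \<alpha> f x\<bar>)"
      by (simp add: norm_bfun_of eq abs_mult)
    \<comment> \<open>Although \<open>\<T> \<alpha>\<close> need not be linear, the values
      \<open>\<bar>c * \<T> \<alpha> f x\<bar>\<close> are the absolute coordinates of a scaled
      vector. Homogeneity of the norm then takes \<open>\<bar>c\<bar>\<close> out of the
      supremum.\<close>
    also have "\<dots> = norm (c *\<^sub>R bfun_of (\<lambda>\<alpha>. \<T> \<alpha> f x))"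
      unfolding norm_bfun by (simp add: apply_bfun_of bdd that scaleR_bcontfun.rep_eq)
    finally show ?thesis by simp
  qed
  ultimately show ?thesis by (simp add: sublinear_operator_def)
qed

section \<open>Transfer of the oscillation inequalities\<close>

lemma boo_ineq_I_bfun_of:
  fixes \<T> :: "'i \<Rightarrow> ('a \<Rightarrow> real) \<Rightarrow> 'a \<Rightarrow> real"
  assumes "\<And>\<alpha>. boo_ineq_I M bhull \<Phi> \<phi> (\<T> \<alpha>) (C \<alpha>) f B\<^sub>0 B"
    and "\<And>\<alpha>. C \<alpha> \<le> K"
    and bdd: "\<And>x. x \<in> B\<^sub>0 \<Longrightarrow> bdd_above (range (\<lambda>\<alpha>. \<bar>\<T> \<alpha> (cut_to f (bhull B)) x\<bar>))"
      "\<And>x. x \<in> B\<^sub>0 \<Longrightarrow> bdd_above (range (\<lambda>\<alpha>. \<bar>\<T> \<alpha> (cut_to f (bhull B\<^sub>0)) x\<bar>))"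
  shows "boo_ineq_I M bhull \<Phi> \<phi> (\<lambda>f x. bfun_of (\<lambda>\<alpha>. \<T> \<alpha> f x)) K f B\<^sub>0 B"
  unfolding boo_ineq_I_def
proof (intro SUP_least ennreal_norm_bfun_le)
  \<comment> \<open>Only one point and one coordinate remain. The ball \<open>B\<close> is the same
    for every index, so the coordinate bounds share the factor
    \<open>ball_norm M \<Phi> \<phi> (bhull B) f\<close>, and \<open>K\<close> absorbs the
    constants.\<close>
  fix x \<alpha> assume x: "x \<in> B\<^sub>0"
  have "ennreal \<bar>\<T> \<alpha> (cut_to f (bhull B)) x - \<T> \<alpha> (cut_to f (bhull B\<^sub>0)) x\<bar>
      \<le> ennreal (C \<alpha>) * ball_norm M \<Phi> \<phi> (bhull B) f"
    using assms(1)[of \<alpha>] x by (simp add: boo_ineq_I_def SUP_le_iff)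
  also have "\<dots> \<le> ennreal K * ball_norm M \<Phi> \<phi> (bhull B) f"
    using assms(2) by (intro mult_right_mono ennreal_leI) auto
  finally show "ennreal \<bar>apply_bcontfun (bfun_of (\<lambda>\<alpha>. \<T> \<alpha> (cut_to f (bhull B)) x) -
      bfun_of (\<lambda>\<alpha>. \<T> \<alpha> (cut_to f (bhull B\<^sub>0)) x)) (discrete \<alpha>)\<bar>
      \<le> ennreal K * ball_norm M \<Phi> \<phi> (bhull B) f"
    by (simp add: minus_bcontfun.rep_eq apply_bfun_of bdd x)
qed

lemma boo_ineq_II_bfun_of:
  fixes \<T> :: "'i \<Rightarrow> ('a \<Rightarrow> real) \<Rightarrow> 'a \<Rightarrow> real"
  assumes "\<And>\<alpha>. boo_ineq_II M BB bhull \<Phi> \<phi> (\<T> \<alpha>) (C \<alpha>) f B"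
    and "\<And>\<alpha>. C \<alpha> \<le> K"
    and bdd: "\<And>x. x \<in> B \<Longrightarrow> bdd_above (range (\<lambda>\<alpha>. \<bar>\<T> \<alpha> f x\<bar>))"
      "\<And>x. x \<in> B \<Longrightarrow> bdd_above (range (\<lambda>\<alpha>. \<bar>\<T> \<alpha> (cut_to f (bhull B)) x\<bar>))"
  shows "boo_ineq_II M BB bhull \<Phi> \<phi> (\<lambda>f x. bfun_of (\<lambda>\<alpha>. \<T> \<alpha> f x)) K f B"
  unfolding boo_ineq_II_def
proof (intro SUP_least ennreal_norm_bfun_le)
  \<comment> \<open>Boundedness of all four vectors makes the coordinate of the double difference
    the double difference of the coordinates.\<close>
  fix x x' \<alpha> assume x: "x \<in> B" "x' \<in> B"
  have "ennreal \<bar>(\<T> \<alpha> f x - \<T> \<alpha> (cut_to f (bhull B)) x) -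
      (\<T> \<alpha> f x' - \<T> \<alpha> (cut_to f (bhull B)) x')\<bar>
      \<le> ennreal (C \<alpha>) * sup_ball_norm M BB \<Phi> \<phi> B f"
    using assms(1)[of \<alpha>] x by (simp add: boo_ineq_II_def SUP_le_iff)
  also have "\<dots> \<le> ennreal K * sup_ball_norm M BB \<Phi> \<phi> B f"
    using assms(2) by (intro mult_right_mono ennreal_leI) auto
  finally show "ennreal \<bar>apply_bcontfun
      ((bfun_of (\<lambda>\<alpha>. \<T> \<alpha> f x) - bfun_of (\<lambda>\<alpha>. \<T> \<alpha> (cut_to f (bhull B)) x)) -
       (bfun_of (\<lambda>\<alpha>. \<T> \<alpha> f x') - bfun_of (\<lambda>\<alpha>. \<T> \<alpha> (cut_to f (bhull B)) x'))) (discrete \<alpha>)\<bar>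
      \<le> ennreal K * sup_ball_norm M BB \<Phi> \<phi> B f"
    by (simp add: minus_bcontfun.rep_eq apply_bfun_of bdd x)
qed

section \<open>The maximal operator\<close>

lemma real_psi_booD:
  assumes "real_psi_boo M BB bhull \<Phi> \<Psi> \<phi> \<psi> T \<T> C1 C2"
  shows "sublinear_operator (space M) (orlicz_morrey M BB \<Psi> \<psi>) \<T>"
    and "boo_bounds M BB bhull \<Phi> \<Psi> \<phi> \<psi> \<T> C1 C2"
    and "\<And>f x. f \<in> orlicz_morrey M BB \<Psi> \<psi> \<Longrightarrow> x \<in> space M \<Longrightarrow> \<bar>T f x\<bar> = \<bar>\<T> f x\<bar>"
  \<comment> \<open>Either \<open>T\<close> is the absolute value of \<open>\<T>\<close> on the
    space, or \<open>\<T> = T\<close>. In the second case \<open>T\<close> may be negative, so only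
    the absolute values are compared.\<close>
  using assms unfolding real_psi_boo_def psi_boo_def
  by (auto dest: linear_imp_sublinear_operator)

theorem theorem2p7:
  fixes M :: "'a measure" and BB :: "'a set set" and bhull :: "'a set \<Rightarrow> 'a set" and C0 :: real
    and \<Phi> \<Psi> :: "ennreal \<Rightarrow> ennreal" and \<phi> \<psi> :: "real \<Rightarrow> real"
    and T \<T> :: "'i \<Rightarrow> ('a \<Rightarrow> real) \<Rightarrow> 'a \<Rightarrow> real"
    and C1 C2 :: "'i \<Rightarrow> real"
  assumes classes: "young_growth \<Phi> \<Psi> \<phi> \<psi>"
    and basis: "ball_basis M BB bhull C0"
    and boo: "\<And>\<alpha>. real_psi_boo M BB bhull \<Phi> \<Psi> \<phi> \<psi> (T \<alpha>) (\<T> \<alpha>) (C1 \<alpha>) (C2 \<alpha>)"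
    and C1_bdd: "bdd_above (range C1)"
    and C2_bdd: "bdd_above (range C2)"
    \<comment> \<open>the ball of condition (I) can be chosen independently of the index\<close>
    and common_ball: "\<And>f B\<^sub>0. f \<in> orlicz_morrey M BB \<Psi> \<psi> \<Longrightarrow> B\<^sub>0 \<in> BB \<Longrightarrow> bhull B\<^sub>0 \<subset> space M \<Longrightarrow>
      \<exists>B\<in>BB. B\<^sub>0 \<subset> B \<and> (\<forall>\<alpha>. boo_ineq_I M bhull \<Phi> \<phi> (\<T> \<alpha>) (C1 \<alpha>) f B\<^sub>0 B)"
    \<comment> \<open>the supremum defining the maximal operator is finite\<close>
    and sup_finite: "\<And>f x. f \<in> orlicz_morrey M BB \<Psi> \<psi> \<Longrightarrow> x \<in> space M \<Longrightarrow>
      bdd_above (range (\<lambda>\<alpha>. \<bar>T \<alpha> f x\<bar>))"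
  shows "\<exists>(\<T>A :: ('a \<Rightarrow> real) \<Rightarrow> 'a \<Rightarrow> 'i bfun) K1 K2.
    K1 \<le> (SUP \<alpha>. C1 \<alpha>) \<and> K2 \<le> (SUP \<alpha>. C2 \<alpha>) \<and>
    psi_boo_sublinear M BB bhull \<Phi> \<Psi> \<phi> \<psi> (sup_operator T) \<T>A K1 K2 \<and>
    ((\<forall>\<alpha>. linear_operator (space M) (orlicz_morrey M BB \<Psi> \<psi>) (\<T> \<alpha>)) \<longrightarrow>
       psi_boo M BB bhull \<Phi> \<Psi> \<phi> \<psi> (sup_operator T) \<T>A K1 K2)"
proof -
  let ?L = "orlicz_morrey M BB \<Psi> \<psi>"
  let ?K1 = "SUP \<alpha>. C1 \<alpha>" and ?K2 = "SUP \<alpha>. C2 \<alpha>"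
  define \<T>A where "\<T>A = (\<lambda>f x. bfun_of (\<lambda>\<alpha>. \<T> \<alpha> f x))"
  \<comment> \<open>Boundedness of the constants makes these real suprema genuine upper bounds; they
    serve as the witnesses \<open>K1\<close> and \<open>K2\<close>.\<close>
  have le: "C1 \<alpha> \<le> ?K1" "C2 \<alpha> \<le> ?K2" for \<alpha>
    using C1_bdd C2_bdd by (auto intro: cSUP_upper)
  have abs_eq: "\<bar>T \<alpha> f x\<bar> = \<bar>\<T> \<alpha> f x\<bar>" if "f \<in> ?L" "x \<in> space M" for \<alpha> f x
    using real_psi_booD(3)[OF boo that] .
  have bdd: "bdd_above (range (\<lambda>\<alpha>. \<bar>\<T> \<alpha> f x\<bar>))" if "f \<in> ?L" "x \<in> space M" for f x
    using sup_finite[OF that] by (simp add: abs_eq that)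
  \<comment> \<open>Balls are measurable, so facts known pointwise on the underlying set apply
    throughout a ball.\<close>
  have space: "x \<in> space M" if "x \<in> B" "B \<in> BB" for x B
    using ball_basisD(1)[OF basis] that sets.sets_into_space by blast
  have cut: "cut_to f (bhull B) \<in> ?L" if "f \<in> ?L" "B \<in> BB" for f B
  proof (rule cut_to_orlicz_morrey[OF _ that(1)])
    show "\<Psi> \<in> young_class" using classes by (simp add: young_growth_def)
    show "bhull B \<in> sets M" using ball_basisD[OF basis] that(2) by blast
  qed
  have norm_eq: "sup_operator T f x = norm (\<T>A f x)" if "f \<in> ?L" "x \<in> space M" for f x
    using that by (simp add: sup_operator_def \<T>A_def norm_bfun_of bdd abs_eq)
  have bounds: "boo_bounds M BB bhull \<Phi> \<Psi> \<phi> \<psi> (\<T> \<alpha>) (C1 \<alpha>) (C2 \<alpha>)" for \<alpha>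
    using real_psi_booD(2)[OF boo] .
  have "0 < C1 \<alpha>" "0 < C2 \<alpha>" for \<alpha>
    using bounds[of \<alpha>] by (auto simp: boo_bounds_def)
  \<comment> \<open>Any single index gives a positive lower bound for each supremum.\<close>
  then have pos: "0 < ?K1" "0 < ?K2"
    using le by (meson less_le_trans)+
  have I: "\<exists>B\<in>BB. B\<^sub>0 \<subset> B \<and> boo_ineq_I M bhull \<Phi> \<phi> \<T>A ?K1 f B\<^sub>0 B"
    if f: "f \<in> ?L" and B0: "B\<^sub>0 \<in> BB" "bhull B\<^sub>0 \<subset> space M" for f B\<^sub>0
  proof -
    \<comment> \<open>Condition (I) for each operator separately would give a ball depending on
      \<alpha>; \<open>common_ball\<close> provides one for all indices at once.\<close>
    obtain B where B: "B \<in> BB" "B\<^sub>0 \<subset> B"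
      "\<And>\<alpha>. boo_ineq_I M bhull \<Phi> \<phi> (\<T> \<alpha>) (C1 \<alpha>) f B\<^sub>0 B"
      using common_ball[OF f B0] by blast
    have "boo_ineq_I M bhull \<Phi> \<phi> \<T>A ?K1 f B\<^sub>0 B"
      unfolding \<T>A_def
      by (rule boo_ineq_I_bfun_of[where C = C1, OF B(3) le(1)])
        (use f B0 B space cut bdd in auto)
    with B show ?thesis by blast
  qed
  have II: "boo_ineq_II M BB bhull \<Phi> \<phi> \<T>A ?K2 f B" if f: "f \<in> ?L" and B: "B \<in> BB" for f B
    unfolding \<T>A_def
  proof (rule boo_ineq_II_bfun_of[where C = C2, OF _ le(2)])
    show "boo_ineq_II M BB bhull \<Phi> \<phi> (\<T> \<alpha>) (C2 \<alpha>) f B" for \<alpha>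
      using bounds[of \<alpha>] f B by (simp add: boo_bounds_def)
  qed (use f B space cut bdd in auto)
  have boundsA: "boo_bounds M BB bhull \<Phi> \<Psi> \<phi> \<psi> \<T>A ?K1 ?K2"
    using pos I II by (simp add: boo_bounds_def)
  have "psi_boo_sublinear M BB bhull \<Phi> \<Psi> \<phi> \<psi> (sup_operator T) \<T>A ?K1 ?K2"
    using sublinear_operator_bfun_of[OF real_psi_booD(1)[OF boo] bdd] norm_eq boundsA
    by (simp add: psi_boo_sublinear_def \<T>A_def)
  \<comment> \<open>The same representing operator and constants serve here; linear components turn
    sublinearity into linearity.\<close>
  moreover have "psi_boo M BB bhull \<Phi> \<Psi> \<phi> \<psi> (sup_operator T) \<T>A ?K1 ?K2"
    if "\<forall>\<alpha>. linear_operator (space M) ?L (\<T> \<alpha>)"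
    using linear_operator_bfun_of[of "space M" ?L \<T>, OF _ bdd] that norm_eq boundsA
    by (simp add: psi_boo_def \<T>A_def)
  ultimately show ?thesis by blast
qed

end
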